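(* Fix $\tau$ in the upper half-plane and let $F(z|\tau)$ and $G(z|\tau)$ be entire functions of $z$ satisfying \[ F(z|\tau)=F(z+\pi|\tau)=q^{3} e^{12iz}F(z+\pi\tau|\tau),\qquad G(z|\tau)=G(z+\pi|\tau)=q^{3} e^{12iz}G(z+\pi\tau|\tau) \] for all $z$. Then there exists a constant $C$ independent of $x$ and $y$ such that for all complex $x,y$, \begin{align*} &\big(F(x|\tau)-F(-x|\tau)\big)\big(G(y|\tau)-G(-y|\tau)\big)-\big(F(y|\tau)-F(-y|\tau)\big)\big(G(x|\tau)-G(-x|\tau)\big)\\ &=C\,\theta_1(x-y|\tau)\theta_1(x+y|\tau)\theta_1(2x|\tau)\theta_1(2y|\tau). \end{align*}
   Context: $q=e^{2\pi i\tau}$ with $\operatorname{Im}\tau>0$; $q^a=e^{2\pi i a\tau}$ for real $a$. The Jacobi theta function is $\theta_1(z|\tau)=2\sum_{n\ge 0}(-1)^n q^{(2n+1)^2/8}\sin((2n+1)z)$. *)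

theory Defs
  imports "HOL-Complex_Analysis.Complex_Analysis"
begin

text \<open>
  \<open>qpow \<tau> a\<close> is $q^a = e^{2\pi i a\tau}$ for real $a$, with $q = e^{2\pi i\tau}$. It is defined through
  \<open>\<tau>\<close> and not through the complex power \<open>powr\<close>, whose principal branch can give a different value
  for non-integral \<open>a\<close>.
\<close>

definition qpow :: "complex \<Rightarrow> real \<Rightarrow> complex" where
  "qpow \<tau> a = exp (2 * of_real pi * \<i> * of_real a * \<tau>)"

text \<open>The quasi-periods in \<open>z\<close> are \<open>\<pi>\<close> and \<open>\<pi>\<tau>\<close>. The series converges for \<open>Im \<tau> > 0\<close>.\<close>

definition theta1 :: "complex \<Rightarrow> complex \<Rightarrow> complex" where
  "theta1 z \<tau> =
     2 * (\<Sum>n. (- 1) ^ n * qpow \<tau> ((2 * real n + 1)\<^sup>2 / 8) * sin ((2 * of_nat n + 1) * z))"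

end

theory Submission
  imports Defs "HOL-Real_Asymp.Real_Asymp"
begin

text \<open>
  The odd parts of \<open>F\<close> and \<open>G\<close> are odd entire functions of period \<open>\<pi>\<close> with
  \<open>f z = q\<^sup>3 e\<^bsup>12iz\<^esup> f (z + \<pi>\<tau>)\<close>. Their Fourier coefficients satisfy \<open>a\<^sub>n = q\<^bsup>n-3\<^esup> a\<^bsub>n-6\<^esub>\<close>
  and \<open>a\<^bsub>-n\<^esub> = - a\<^sub>n\<close>, hence are determined by \<open>a\<^sub>1\<close> and \<open>a\<^sub>2\<close>, and the space of such functions is
  at most two-dimensional. The theta product \<open>R x y\<close> on the right-hand side is antisymmetric, is not
  identically zero, and belongs to this space in each variable. If \<open>R u v \<noteq> 0\<close>, then \<open>R \<cdot> u\<close> and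
  \<open>R \<cdot> v\<close> form a basis, so that any alternating form of two elements is a multiple of \<open>R\<close>. The zeros
  of \<open>\<theta>\<^sub>1\<close> are never needed.
\<close>

section \<open>Integrals of entire functions over a period\<close>

definition period_integral :: "(complex \<Rightarrow> complex) \<Rightarrow> complex" where
  "period_integral h = contour_integral (linepath 0 (of_real pi)) h"

text \<open>The difference on the left has derivative zero, so it may be evaluated at any base point.\<close>

lemma period_integral_primitive:
  assumes per: "\<And>z. h (z + of_real pi) = h z"
    and P: "\<And>z. (P has_field_derivative h z) (at z)"
  shows "P (z + of_real pi) - P z = period_integral h"
proof -
  have "\<exists>c. \<forall>z\<in>UNIV. P (z + of_real pi) - P z = c"
  proof (rule has_field_derivative_zero_constant)
    fix z :: complex
    have "((\<lambda>z. P (z + of_real pi)) has_field_derivative h (z + of_real pi)) (at z)"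
      using P[of "z + of_real pi"] DERIV_shift by blast
    from DERIV_diff[OF this P] show "((\<lambda>z. P (z + of_real pi) - P z) has_field_derivative 0) (at z)"
      by (simp add: per)
  qed auto
  then have "P (z + of_real pi) - P z = P (0 + of_real pi) - P 0"
    by (metis UNIV_I)
  moreover have "(h has_contour_integral (P (pathfinish (linepath 0 (of_real pi))) - P (pathstart (linepath 0 (of_real pi)))))
      (linepath 0 (of_real pi))"
    by (rule contour_integral_primitive[where S = UNIV], rule P, rule valid_path_linepath, rule subset_UNIV)
  ultimately show ?thesis
    by (simp add: period_integral_def contour_integral_unique)
qed

lemma entire_primitive:
  fixes h :: "complex \<Rightarrow> complex"
  assumes "h holomorphic_on UNIV"
  obtains P where "\<And>z. (P has_field_derivative h z) (at z)"
  using holomorphic_convex_primitive'[of UNIV h] assms by auto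

text \<open>Both sides are increments of one primitive of \<open>h\<close> over a translate of the
  period, and these agree at every base point. The shift \<open>c\<close> may be complex, so this
  replaces Cauchy's theorem on a parallelogram.\<close>

lemma period_integral_shift:
  assumes hol: "h holomorphic_on UNIV" and per: "\<And>z. h (z + of_real pi) = h z"
  shows "period_integral (\<lambda>z. h (z + c)) = period_integral h"
proof -
  obtain P where P: "\<And>z. (P has_field_derivative h z) (at z)"
    using entire_primitive[OF hol] by blast
  have "P (0 + of_real pi + c) - P (0 + c) = period_integral (\<lambda>z. h (z + c))"
  proof (rule period_integral_primitive[where P = "\<lambda>z. P (z + c)"])
    show "((\<lambda>z. P (z + c)) has_field_derivative h (z + c)) (at z)" for z
      using P[of "z + c"] DERIV_shift by blast
    show "h (z + of_real pi + c) = h (z + c)" for z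
      using per[of "z + c"] by (simp add: algebra_simps)
  qed
  moreover have "P (c + of_real pi) - P c = period_integral h"
    by (rule period_integral_primitive[OF per P])
  ultimately show ?thesis
    by (simp add: algebra_simps)
qed

lemma period_integral_reflect:
  assumes hol: "h holomorphic_on UNIV" and per: "\<And>z. h (z + of_real pi) = h z"
  shows "period_integral (\<lambda>z. h (- z)) = period_integral h"
proof -
  obtain P where P: "\<And>z. (P has_field_derivative h z) (at z)"
    using entire_primitive[OF hol] by blast
  have "- P (- (0 + of_real pi)) - (- P (- 0)) = period_integral (\<lambda>z. h (- z))"
  proof (rule period_integral_primitive[where P = "\<lambda>z. - P (- z)"])
    show "((\<lambda>z. - P (- z)) has_field_derivative h (- z)) (at z)" for z
      by (auto intro!: derivative_eq_intros DERIV_chain2[OF P])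
    show "h (- (z + of_real pi)) = h (- z)" for z
      using per[of "- z - of_real pi"] by simp
  qed
  moreover have "P (- of_real pi + of_real pi) - P (- of_real pi) = period_integral h"
    by (rule period_integral_primitive[OF per P])
  ultimately show ?thesis
    by simp
qed

text \<open>The integral may be computed on any segment from \<open>c\<close> to
  \<open>c + pi\<close>, whose length is pi. The gain is that \<open>c\<close> may lie off the real
  axis.\<close>

lemma period_integral_bound:
  assumes hol: "h holomorphic_on UNIV" and per: "\<And>z. h (z + of_real pi) = h z"
    and bound: "\<And>z. z \<in> closed_segment c (c + of_real pi) \<Longrightarrow> norm (h z) \<le> M"
  shows "norm (period_integral h) \<le> M * pi"
proof -
  obtain P where P: "\<And>z. (P has_field_derivative h z) (at z)"
    using entire_primitive[OF hol] by blast
  have "(h has_contour_integral (P (pathfinish (linepath c (c + of_real pi))) - P (pathstart (linepath c (c + of_real pi)))))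
      (linepath c (c + of_real pi))"
    by (rule contour_integral_primitive[where S = UNIV]) (auto simp: P)
  then have "(h has_contour_integral period_integral h) (linepath c (c + of_real pi))"
    by (simp add: period_integral_primitive[OF per P])
  moreover have "0 \<le> M"
    using bound[of c] norm_ge_zero[of "h c"] by (meson ends_in_segment(1) order_trans)
  ultimately have "norm (period_integral h) \<le> M * norm (c + of_real pi - c)"
    using bound by (intro has_contour_integral_bound_linepath) auto
  then show ?thesis by simp
qed

lemma entire_contour_integrable_linepath:
  "h holomorphic_on UNIV \<Longrightarrow> h contour_integrable_on linepath a b"
  by (intro contour_integrable_continuous_linepath holomorphic_on_imp_continuous_on)
     (auto intro: holomorphic_on_subset)

lemma period_integral_add:
  "h holomorphic_on UNIV \<Longrightarrow> k holomorphic_on UNIV \<Longrightarrow>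
    period_integral (\<lambda>z. h z + k z) = period_integral h + period_integral k"
  by (simp add: period_integral_def contour_integral_add entire_contour_integrable_linepath)

lemma period_integral_cmult:
  "h holomorphic_on UNIV \<Longrightarrow> period_integral (\<lambda>z. c * h z) = c * period_integral h"
  by (simp add: period_integral_def contour_integral_lmul entire_contour_integrable_linepath)


section \<open>Fourier coefficients of entire functions of period \<open>\<pi>\<close>\<close>

definition fourier_char :: "int \<Rightarrow> complex \<Rightarrow> complex" where
  "fourier_char n z = exp (2 * \<i> * of_int n * z)"

text \<open>Unnormalized: this is pi times the usual Fourier coefficient.\<close>

definition fourier_coeff :: "(complex \<Rightarrow> complex) \<Rightarrow> int \<Rightarrow> complex" where
  "fourier_coeff f n = period_integral (\<lambda>z. f z * fourier_char (- n) z)"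

definition entire_periodic :: "(complex \<Rightarrow> complex) \<Rightarrow> bool" where
  "entire_periodic f \<longleftrightarrow> f holomorphic_on UNIV \<and> (\<forall>z. f (z + of_real pi) = f z)"

lemma entire_periodicD:
  assumes "entire_periodic f"
  shows "f holomorphic_on UNIV" "f (z + of_real pi) = f z"
  using assms by (auto simp: entire_periodic_def)

lemma holomorphic_fourier_char [holomorphic_intros]: "fourier_char n holomorphic_on S"
  unfolding fourier_char_def[abs_def] by (intro holomorphic_intros)

lemma fourier_char_add: "fourier_char n (z + w) = fourier_char n z * fourier_char n w"
  by (simp add: fourier_char_def algebra_simps flip: exp_add)

lemma fourier_char_index_add: "fourier_char (m + n) z = fourier_char m z * fourier_char n z"
  by (simp add: fourier_char_def algebra_simps flip: exp_add)

lemma fourier_char_minus: "fourier_char n (- z) = fourier_char (- n) z"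
  by (simp add: fourier_char_def)

lemma fourier_char_zero [simp]: "fourier_char 0 z = 1" "fourier_char n 0 = 1"
  by (simp_all add: fourier_char_def)

lemma fourier_char_nonzero [simp]: "fourier_char n z \<noteq> 0"
  by (simp add: fourier_char_def)

lemma fourier_char_pi [simp]: "fourier_char n (of_real pi) = 1"
  unfolding fourier_char_def exp_eq_1 by (auto intro!: exI[of _ n])

lemma entire_periodic_mult_char:
  "entire_periodic f \<Longrightarrow> entire_periodic (\<lambda>z. f z * fourier_char n z)"
  by (auto simp: entire_periodic_def fourier_char_add intro!: holomorphic_intros)

lemma holomorphic_mult_char:
  "f holomorphic_on UNIV \<Longrightarrow> (\<lambda>z. f z * fourier_char n z) holomorphic_on UNIV"
  by (intro holomorphic_intros)

lemma fourier_coeff_add: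
  "f holomorphic_on UNIV \<Longrightarrow> g holomorphic_on UNIV \<Longrightarrow>
    fourier_coeff (\<lambda>z. f z + g z) n = fourier_coeff f n + fourier_coeff g n"
  by (simp add: fourier_coeff_def distrib_right period_integral_add holomorphic_mult_char)

lemma fourier_coeff_cmult:
  "f holomorphic_on UNIV \<Longrightarrow> fourier_coeff (\<lambda>z. c * f z) n = c * fourier_coeff f n"
  by (simp add: fourier_coeff_def mult.assoc period_integral_cmult holomorphic_mult_char)

lemma fourier_coeff_mult_char:
  "fourier_coeff (\<lambda>z. fourier_char m z * f z) n = fourier_coeff f (n - m)"
proof -
  have "fourier_char m z * f z * fourier_char (- n) z = f z * fourier_char (- (n - m)) z" for z
    using fourier_char_index_add[of m "- n" z] by (simp add: mult_ac)
  then show ?thesis by (simp only: fourier_coeff_def)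
qed

text \<open>Translation multiplies a character by a constant. Since \<open>c\<close> may be complex,
  \<open>c = pi * \<tau>\<close> will turn quasi-periodicity into a recursion for the
  coefficients.\<close>

lemma fourier_coeff_shift:
  assumes "entire_periodic f"
  shows "fourier_coeff (\<lambda>z. f (z + c)) n = fourier_char n c * fourier_coeff f n"
proof -
  note h = entire_periodicD[OF entire_periodic_mult_char[OF assms]]
  have "f (z + c) * fourier_char (- n) z =
      fourier_char n c * (f (z + c) * fourier_char (- n) (z + c))" for z
    using fourier_char_index_add[of n "- n" c] by (simp add: fourier_char_add)
  then have "fourier_coeff (\<lambda>z. f (z + c)) n =
      period_integral (\<lambda>z. fourier_char n c * (f (z + c) * fourier_char (- n) (z + c)))"
    by (simp only: fourier_coeff_def)
  also have "\<dots> = fourier_char n c * period_integral (\<lambda>z. f (z + c) * fourier_char (- n) (z + c))"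
    by (intro period_integral_cmult holomorphic_on_compose[OF _ holomorphic_on_subset[OF h(1)], unfolded o_def]
        holomorphic_intros) auto
  also have "\<dots> = fourier_char n c * fourier_coeff f n"
    by (simp add: fourier_coeff_def period_integral_shift[OF h])
  finally show ?thesis .
qed

lemma fourier_coeff_reflect:
  assumes "entire_periodic f"
  shows "fourier_coeff (\<lambda>z. f (- z)) n = fourier_coeff f (- n)"
  using period_integral_reflect[OF entire_periodicD[OF entire_periodic_mult_char[OF assms]], of n]
  by (simp add: fourier_coeff_def fourier_char_minus)

lemma fourier_coeff_const: "n \<noteq> 0 \<Longrightarrow> fourier_coeff (\<lambda>_. c) n = 0"
  and fourier_coeff_const_0: "fourier_coeff (\<lambda>_. c) 0 = c * of_real pi"
proof -
  show "fourier_coeff (\<lambda>_. c) 0 = c * of_real pi"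
    by (simp add: fourier_coeff_def period_integral_def contour_integral_const_linepath)
  assume n: "n \<noteq> 0"
  \<comment> \<open>This primitive again has period pi, so its increment vanishes.\<close>
  have "c * fourier_char (- n) (0 + of_real pi) / (- 2 * \<i> * of_int n)
      - c * fourier_char (- n) 0 / (- 2 * \<i> * of_int n) = period_integral (\<lambda>z. c * fourier_char (- n) z)"
  proof (rule period_integral_primitive[where P = "\<lambda>z. c * fourier_char (- n) z / (- 2 * \<i> * of_int n)"])
    show "((\<lambda>z. c * fourier_char (- n) z / (- 2 * \<i> * of_int n)) has_field_derivative
        c * fourier_char (- n) z) (at z)" for z
      using n unfolding fourier_char_def by (auto intro!: derivative_eq_intros simp: field_simps)
  qed (simp add: fourier_char_add)
  then show "fourier_coeff (\<lambda>_. c) n = 0"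
    by (simp add: fourier_coeff_def)
qed

text \<open>Moving the contour to the line \<open>Im z = t\<close> makes the coefficients decay exponentially.\<close>

lemma fourier_coeff_decay:
  assumes "entire_periodic f"
  obtains M where "\<And>n. norm (fourier_coeff f n) \<le> M * exp (2 * of_int n * t)"
proof -
  define c where "c = \<i> * of_real t"
  let ?S = "closed_segment c (c + of_real pi)"
  have "bounded (f ` ?S)"
    by (intro compact_imp_bounded compact_continuous_image holomorphic_on_imp_continuous_on
        holomorphic_on_subset[OF entire_periodicD(1)[OF assms]]) auto
  then obtain M where M: "\<And>z. z \<in> ?S \<Longrightarrow> norm (f z) \<le> M"
    by (auto simp: bounded_iff)
  have "norm (fourier_coeff f n) \<le> M * exp (2 * of_int n * t) * pi" for n
    unfolding fourier_coeff_def
  proof (rule period_integral_bound[OF entire_periodicD[OF entire_periodic_mult_char[OF assms]]])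
    fix z assume z: "z \<in> ?S"
    then obtain u where "z = (1 - u) *\<^sub>R c + u *\<^sub>R (c + of_real pi)"
      by (auto simp: closed_segment_def)
    then have "Im z = t"
      by (simp add: c_def algebra_simps)
    then have "norm (fourier_char (- n) z) = exp (2 * of_int n * t)"
      by (simp add: fourier_char_def norm_exp_eq_Re)
    then show "norm (f z * fourier_char (- n) z) \<le> M * exp (2 * of_int n * t)"
      using M[OF z] by (simp add: norm_mult)
  qed
  then show ?thesis
    by (intro that[of "M * pi"]) (simp add: mult_ac)
qed

section \<open>Vanishing Fourier coefficients force the function to vanish\<close>

lemma exp_decay_bound_zero:
  fixes x M :: real
  assumes "\<And>k::nat. x \<le> M * exp (- 2 * real k)"
  shows "x \<le> 0"
proof -
  have "(\<lambda>k::nat. M * exp (- 2 * real k)) \<longlonglongrightarrow> M * 0"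
    by (intro tendsto_mult tendsto_const filterlim_compose[OF exp_at_bot]) real_asymp
  then have "x \<le> M * 0"
    by (rule LIMSEQ_le_const) (use assms in auto)
  then show ?thesis by simp
qed

lemma periodic_int_shift:
  assumes "\<And>z::complex. f (z + of_real pi) = f z"
  shows "f (z + of_int n * of_real pi) = f z"
proof -
  have nat: "f (z + of_nat k * of_real pi) = f z" for k z
  proof (induction k arbitrary: z)
    case (Suc k)
    then show ?case
      using assms[of "z + of_nat k * of_real pi"] by (simp add: algebra_simps)
  qed simp
  show ?thesis
  proof (cases "n \<ge> 0")
    case True
    then show ?thesis using nat[of z "nat n"] by simp
  next
    case False
    then show ?thesis using nat[of "z + of_int n * of_real pi" "nat (- n)"] by simp
  qed
qed

lemma fourier_char_1_eq_1_iff: "fourier_char 1 z = 1 \<longleftrightarrow> (\<exists>n::int. z = of_int n * of_real pi)"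
proof
  assume "fourier_char 1 z = 1"
  then obtain n :: int where "Re (2 * \<i> * z) = 0" "Im (2 * \<i> * z) = of_int (2 * n) * pi"
    unfolding fourier_char_def exp_eq_1 by auto
  then show "\<exists>n::int. z = of_int n * of_real pi"
    by (intro exI[of _ n]) (auto simp: complex_eq_iff)
next
  assume "\<exists>n::int. z = of_int n * of_real pi"
  then show "fourier_char 1 z = 1"
    using periodic_int_shift[of "fourier_char 1" 0] by (auto simp: fourier_char_add)
qed

text \<open>The zeros of \<open>fourier_char 1 z - 1\<close> are the multiples of pi and are simple.
  By periodicity \<open>f\<close> vanishes at all of them, so the singularities of the quotient are
  removable.\<close>

lemma entire_periodic_quotient:
  assumes f: "entire_periodic f" and f0: "f 0 = 0"
  obtains g where "entire_periodic g" "\<And>z. f z = (fourier_char 1 z - 1) * g z"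
proof -
  define g where "g = (\<lambda>z. if fourier_char 1 z = 1 then deriv f 0 / (2 * \<i>) else f z / (fourier_char 1 z - 1))"
  \<comment> \<open>\<open>h\<close> and \<open>k\<close> are the difference quotients at 0 of the
    numerator and of \<open>fourier_char 1\<close>; both are entire, and
    \<open>k 0 = 2 * \<i>\<close>. Hence \<open>g = h / k\<close> is holomorphic near 0.\<close>
  define h where "h = (\<lambda>z. if z = 0 then deriv f 0 else (f z - f 0) / (z - 0))"
  define k where "k = (\<lambda>z. if z = 0 then deriv (fourier_char 1) 0 else (fourier_char 1 z - fourier_char 1 0) / (z - 0))"
  note fhol = entire_periodicD(1)[OF f] and fper = entire_periodicD(2)[OF f]
  have h: "h holomorphic_on UNIV" and k: "k holomorphic_on UNIV"
    unfolding h_def k_def by (rule pole_lemma_open; simp add: fhol holomorphic_intros)+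
  have d: "deriv (fourier_char 1) 0 = 2 * \<i>"
    unfolding fourier_char_def[abs_def]
    by (rule DERIV_imp_deriv) (auto intro!: derivative_eq_intros)
  have gper: "g (z + of_real pi) = g z" for z
    by (simp add: g_def fper fourier_char_add)
  have g_eq: "g z = h z / k z" if "k z \<noteq> 0" for z
    using that by (auto simp: g_def h_def k_def d f0)
  have diff0: "g field_differentiable at 0"
  proof -
    have op: "open {z. k z \<noteq> 0}"
      using open_Collect_neq[of k "\<lambda>_. 0"] holomorphic_on_imp_continuous_on[OF k] by simp
    have "(\<lambda>z. h z / k z) holomorphic_on {z. k z \<noteq> 0}"
      by (intro holomorphic_intros holomorphic_on_subset[OF h] holomorphic_on_subset[OF k]) auto
    then have "g holomorphic_on {z. k z \<noteq> 0}"
      by (rule holomorphic_transform) (simp add: g_eq)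
    moreover have "k 0 \<noteq> 0" by (simp add: k_def d)
    ultimately show ?thesis
      using holomorphic_on_imp_differentiable_at[OF _ op] by blast
  qed
  have "g field_differentiable at z" for z
  proof (cases "fourier_char 1 z = 1")
    case True
    then obtain n :: int where n: "z = of_int n * of_real pi"
      by (auto simp: fourier_char_1_eq_1_iff)
    \<comment> \<open>By periodicity, \<open>g\<close> near any other multiple of pi is a translate
      of \<open>g\<close> near 0.\<close>
    have "g w = g (w - z)" for w
      using periodic_int_shift[of g "w - z" n, OF gper] by (simp add: n)
    moreover have "(\<lambda>w. g (w - z)) field_differentiable at z"
    proof -
      obtain D where "(g has_field_derivative D) (at (z - z))"
        using diff0 by (auto simp: field_differentiable_def)
      then have "((\<lambda>w. g (w - z)) has_field_derivative D * 1) (at z)"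
        by (rule DERIV_chain2) (auto intro!: derivative_eq_intros)
      then show ?thesis by (auto simp: field_differentiable_def)
    qed
    ultimately show ?thesis by simp
  next
    case False
    have op: "open {z. fourier_char 1 z \<noteq> 1}"
      using open_Collect_neq[of "fourier_char 1" "\<lambda>_. 1"]
        holomorphic_on_imp_continuous_on[OF holomorphic_fourier_char] by simp
    have "(\<lambda>z. f z / (fourier_char 1 z - 1)) holomorphic_on {z. fourier_char 1 z \<noteq> 1}"
      by (intro holomorphic_intros holomorphic_on_subset[OF fhol]) auto
    then have "g holomorphic_on {z. fourier_char 1 z \<noteq> 1}"
      by (rule holomorphic_transform) (simp add: g_def)
    with False show ?thesis
      using holomorphic_on_imp_differentiable_at[OF _ op] by blast
  qed
  then have "entire_periodic g"
    by (simp add: entire_periodic_def gper holomorphic_on_def field_differentiable_at_within)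
  moreover have "f z = (fourier_char 1 z - 1) * g z" for z
  proof (cases "fourier_char 1 z = 1")
    case True
    then obtain n :: int where "z = 0 + of_int n * of_real pi"
      by (auto simp: fourier_char_1_eq_1_iff)
    then have "f z = 0"
      using periodic_int_shift[of f 0 n, OF fper] f0 by simp
    with True show ?thesis by simp
  qed (simp add: g_def)
  ultimately show ?thesis using that by blast
qed

text \<open>Chernoff's argument: dividing \<open>f - f 0\<close> by \<open>e\<^sup>2\<^sup>i\<^sup>z - 1\<close> makes the coefficients of \<open>f - f 0\<close> telescope.\<close>

lemma fourier_coeff_zero_imp_zero_at_0:
  assumes f: "entire_periodic f" and zero: "\<And>n. fourier_coeff f n = 0"
  shows "f 0 = 0"
proof -
  have "entire_periodic (\<lambda>z. f z - f 0)"
    using f by (auto simp: entire_periodic_def intro!: holomorphic_intros)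
  then obtain g where g: "entire_periodic g"
    and eq: "\<And>z. f z - f 0 = (fourier_char 1 z - 1) * g z"
    by (rule entire_periodic_quotient) auto
  note ghol = entire_periodicD(1)[OF g]
  have f_eq: "f = (\<lambda>z. f 0 + (fourier_char 1 z * g z + (- 1) * g z))"
    using eq by (auto simp: fun_eq_iff algebra_simps)
  have tel: "fourier_coeff (\<lambda>_. f 0) n + (fourier_coeff g (n - 1) - fourier_coeff g n) = 0" for n
  proof -
    have "0 = fourier_coeff (\<lambda>z. f 0 + (fourier_char 1 z * g z + (- 1) * g z)) n"
      using zero[of n] f_eq by metis
    also have "\<dots> = fourier_coeff (\<lambda>_. f 0) n + (fourier_coeff g (n - 1) + (- 1) * fourier_coeff g n)"
      by (subst fourier_coeff_add fourier_coeff_cmult fourier_coeff_mult_char;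
          (intro holomorphic_intros ghol)?)+ simp
    finally show ?thesis by simp
  qed
  \<comment> \<open>The constant \<open>f 0\<close> contributes only at index 0. So the coefficients
    of \<open>g\<close> are constant on the indices \<ge> 0 and constant on the indices \<le> -1,
    with a possible jump between -1 and 0.\<close>
  have step: "fourier_coeff g (n - 1) = fourier_coeff g n" if "n \<noteq> 0" for n
    using tel[of n] fourier_coeff_const[OF that, of "f 0"] by simp
  have up: "fourier_coeff g (int k) = fourier_coeff g 0" for k
    by (induction k) (use step[of "int (Suc _)"] in auto)
  have down: "fourier_coeff g (- 1 - int k) = fourier_coeff g (- 1)" for k
  proof (induction k)
    case (Suc k)
    then show ?case using step[of "- 1 - int k"] by (simp add: algebra_simps)
  qed simp
  \<comment> \<open>Decay on the line \<open>Im z = -1\<close> kills the block of nonnegative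
    indices; decay on \<open>Im z = 1\<close> then kills the negative block.\<close>
  obtain M where "\<And>n. norm (fourier_coeff g n) \<le> M * exp (2 * of_int n * (- 1))"
    using fourier_coeff_decay[OF g] by blast
  from this[of "int _"] have "norm (fourier_coeff g 0) \<le> 0"
    by (intro exp_decay_bound_zero[of _ M]) (simp add: up)
  moreover obtain M' where M': "\<And>n. norm (fourier_coeff g n) \<le> M' * exp (2 * of_int n * 1)"
    using fourier_coeff_decay[OF g] by blast
  have "norm (fourier_coeff g (- 1)) \<le> (M' * exp (- 2)) * exp (- 2 * real k)" for k
    using M'[of "- 1 - int k"] by (simp add: down algebra_simps flip: exp_add)
  then have "norm (fourier_coeff g (- 1)) \<le> 0"
    by (rule exp_decay_bound_zero)
  \<comment> \<open>With both blocks zero, the relation at index 0 reads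
    \<open>f 0 * pi = 0\<close>.\<close>
  ultimately show ?thesis
    using tel[of 0] by (simp add: fourier_coeff_const_0)
qed

text \<open>Translating \<open>z\<close> to the origin only rescales the coefficients, so they
  remain zero.\<close>

lemma fourier_coeff_zero_imp_zero:
  assumes f: "entire_periodic f" and zero: "\<And>n. fourier_coeff f n = 0"
  shows "f z = 0"
proof -
  have hol: "(\<lambda>w. f (w + z)) holomorphic_on UNIV"
    by (intro holomorphic_on_compose[OF _ holomorphic_on_subset[OF entire_periodicD(1)[OF f]], unfolded o_def]
        holomorphic_intros) auto
  have "f (w + of_real pi + z) = f (w + z)" for w
    using entire_periodicD(2)[OF f, of "w + z"] by (simp add: algebra_simps)
  with hol have "entire_periodic (\<lambda>w. f (w + z))"
    by (simp add: entire_periodic_def)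
  from fourier_coeff_zero_imp_zero_at_0[OF this] show ?thesis
    by (simp add: fourier_coeff_shift[OF f] zero)
qed


section \<open>The theta function\<close>

definition theta_coeff :: "complex \<Rightarrow> nat \<Rightarrow> complex" where
  "theta_coeff \<tau> n = (- 1) ^ n * qpow \<tau> ((2 * real n + 1)\<^sup>2 / 8)"

text \<open>A partial theta function: the one-sided half of the bilateral series of
  \<open>theta1\<close>, in the variable \<open>w = exp (2 * \<i> * z)\<close>. It is entire in
  \<open>w\<close>, and \<open>theta1\<close> is a combination of its values at \<open>w\<close> and
  \<open>1/w\<close>.\<close>

definition theta_series :: "complex \<Rightarrow> complex \<Rightarrow> complex" where
  "theta_series \<tau> w = (\<Sum>n. theta_coeff \<tau> n * w ^ n)"

lemma qpow_add: "qpow \<tau> (a + b) = qpow \<tau> a * qpow \<tau> b"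
  by (simp add: qpow_def algebra_simps flip: exp_add)

lemma qpow_nonzero [simp]: "qpow \<tau> a \<noteq> 0"
  by (simp add: qpow_def)

lemma qpow_of_nat: "qpow \<tau> (real n) = qpow \<tau> 1 ^ n"
  unfolding qpow_def by (subst exp_of_nat_mult[symmetric]) (simp add: mult_ac)

lemma norm_qpow_1_less_1: "Im \<tau> > 0 \<Longrightarrow> norm (qpow \<tau> 1) < 1"
  by (simp add: qpow_def norm_exp_eq_Re)

text \<open>Consecutive exponents differ by n + 1. This ratio drives both the convergence for every
  \<open>w\<close> and the functional equation of the series.\<close>

lemma theta_coeff_Suc: "theta_coeff \<tau> (Suc n) = - (qpow \<tau> 1 ^ Suc n * theta_coeff \<tau> n)"
proof -
  have "(2 * real (Suc n) + 1)\<^sup>2 / 8 = real (Suc n) + (2 * real n + 1)\<^sup>2 / 8"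
    by (simp add: power2_eq_square field_simps)
  then show ?thesis
    unfolding theta_coeff_def by (simp only: qpow_add qpow_of_nat) simp
qed

lemma theta_coeff_0_nonzero: "theta_coeff \<tau> 0 \<noteq> 0"
  by (simp add: theta_coeff_def)

lemma summable_theta_series:
  assumes "Im \<tau> > 0"
  shows "summable (\<lambda>n. theta_coeff \<tau> n * w ^ n)"
proof -
  have "(\<lambda>n. norm (qpow \<tau> 1) ^ Suc n * norm w) \<longlonglongrightarrow> 0 * norm w"
    by (intro tendsto_mult tendsto_const LIMSEQ_Suc LIMSEQ_power_zero)
       (simp add: norm_qpow_1_less_1 assms)
  then have "eventually (\<lambda>n. norm (qpow \<tau> 1) ^ Suc n * norm w < 1/2) sequentially"
    by (rule order_tendstoD) simp
  then obtain N where N: "\<And>n. n \<ge> N \<Longrightarrow> norm (qpow \<tau> 1) ^ Suc n * norm w < 1/2"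
    by (auto simp: eventually_sequentially)
  show ?thesis
  proof (rule summable_ratio_test)
    fix n assume "n \<ge> N"
    have "norm (theta_coeff \<tau> (Suc n) * w ^ Suc n) =
        (norm (qpow \<tau> 1) ^ Suc n * norm w) * norm (theta_coeff \<tau> n * w ^ n)"
      by (simp add: theta_coeff_Suc norm_mult norm_power)
    also have "\<dots> \<le> 1/2 * norm (theta_coeff \<tau> n * w ^ n)"
      using N[OF \<open>n \<ge> N\<close>] by (intro mult_right_mono) auto
    finally show "norm (theta_coeff \<tau> (Suc n) * w ^ Suc n) \<le> 1/2 * norm (theta_coeff \<tau> n * w ^ n)" .
  qed simp
qed

lemma theta_series_holomorphic:
  assumes "Im \<tau> > 0"
  shows "theta_series \<tau> holomorphic_on S"
proof -
  have "theta_series \<tau> field_differentiable at w" for w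
    using termdiffs_strong_converges_everywhere[OF summable_theta_series[OF assms]]
    unfolding field_differentiable_def theta_series_def[abs_def] by blast
  then show ?thesis
    by (simp add: holomorphic_on_def field_differentiable_at_within)
qed

text \<open>Split off the term of index 0 and apply the coefficient recursion to the rest. Passing
  from \<open>w\<close> to \<open>q w\<close> corresponds to passing from \<open>z\<close> to
  \<open>z + pi * \<tau>\<close>.\<close>

lemma theta_series_rec:
  assumes "Im \<tau> > 0"
  shows "theta_series \<tau> w = theta_coeff \<tau> 0 - qpow \<tau> 1 * w * theta_series \<tau> (qpow \<tau> 1 * w)"
proof -
  let ?q = "qpow \<tau> 1"
  have "theta_coeff \<tau> (Suc n) * w ^ Suc n = - (?q * w) * (theta_coeff \<tau> n * (?q * w) ^ n)" for n
    by (simp add: theta_coeff_Suc power_mult_distrib)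
  then have "(\<Sum>n. theta_coeff \<tau> (Suc n) * w ^ Suc n) = - (?q * w) * theta_series \<tau> (?q * w)"
    unfolding theta_series_def
    by (simp only: suminf_mult[OF summable_theta_series[OF assms]])
  then show ?thesis
    using suminf_split_head[OF summable_theta_series[OF assms], of w]
    by (simp add: theta_series_def algebra_simps)
qed

lemma theta1_eq:
  assumes "Im \<tau> > 0"
  shows "theta1 z \<tau> = - \<i> * (exp (\<i> * z) * theta_series \<tau> (exp (\<i> * z) ^ 2)
      - inverse (exp (\<i> * z)) * theta_series \<tau> (inverse (exp (\<i> * z)) ^ 2))"
proof -
  define s where "s = exp (\<i> * z)"
  have s: "s \<noteq> 0" by (simp add: s_def)
  have sin: "sin ((2 * of_nat n + 1) * z) = - \<i> / 2 * (s * (s\<^sup>2) ^ n - inverse s * ((inverse s)\<^sup>2) ^ n)" for n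
  proof -
    have "exp (\<i> * ((2 * of_nat n + 1) * z)) = s * (s\<^sup>2) ^ n"
      unfolding s_def by (simp flip: exp_of_nat_mult exp_add power_mult) (simp add: algebra_simps)
    moreover have "exp (- (\<i> * ((2 * of_nat n + 1) * z))) = inverse s * ((inverse s)\<^sup>2) ^ n"
      unfolding s_def by (simp flip: exp_of_nat_mult exp_add power_mult exp_minus) (simp add: algebra_simps)
    ultimately show ?thesis
      by (simp only: sin_exp_eq) (simp add: divide_i right_diff_distrib flip: divide_divide_eq_left)
  qed
  have term_eq: "(- 1) ^ n * qpow \<tau> ((2 * real n + 1)\<^sup>2 / 8) * sin ((2 * of_nat n + 1) * z) =
      (- \<i> / 2) * (s * (theta_coeff \<tau> n * (s\<^sup>2) ^ n) - inverse s * (theta_coeff \<tau> n * ((inverse s)\<^sup>2) ^ n))" for n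
    unfolding sin theta_coeff_def by (simp add: algebra_simps)
  note sums = summable_sums[OF summable_theta_series[OF assms], folded theta_series_def]
  have "(\<lambda>n. (- 1) ^ n * qpow \<tau> ((2 * real n + 1)\<^sup>2 / 8) * sin ((2 * of_nat n + 1) * z)) sums
      ((- \<i> / 2) * (s * theta_series \<tau> (s\<^sup>2) - inverse s * theta_series \<tau> ((inverse s)\<^sup>2)))"
    unfolding term_eq by (intro sums_mult sums_diff sums)
  then show ?thesis
    by (simp add: theta1_def s_def sums_unique[symmetric] field_simps)
qed

section \<open>Transformation laws and non-vanishing of \<open>theta1\<close>\<close>

lemma theta1_holomorphic:
  assumes "Im \<tau> > 0"
  shows "(\<lambda>z. theta1 z \<tau>) holomorphic_on UNIV"
  unfolding theta1_eq[OF assms]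
  by (intro holomorphic_intros holomorphic_on_compose[OF _ theta_series_holomorphic[OF assms], unfolded o_def]) auto

lemma theta1_holomorphic_compose [holomorphic_intros]:
  assumes "Im \<tau> > 0" "f holomorphic_on S"
  shows "(\<lambda>z. theta1 (f z) \<tau>) holomorphic_on S"
  using holomorphic_on_compose_gen[OF assms(2) theta1_holomorphic[OF assms(1)]] by (auto simp: o_def)

lemma theta1_minus: "Im \<tau> > 0 \<Longrightarrow> theta1 (- z) \<tau> = - theta1 z \<tau>"
  by (simp add: theta1_eq exp_minus algebra_simps)

lemma theta1_add_pi: "Im \<tau> > 0 \<Longrightarrow> theta1 (z + of_real pi) \<tau> = - theta1 z \<tau>"
  by (simp add: theta1_eq distrib_left exp_add algebra_simps)

lemma theta1_add_pi_tau:
  assumes "Im \<tau> > 0"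
  shows "theta1 (z + of_real pi * \<tau>) \<tau> = - (qpow \<tau> (- 1/2) * exp (- 2 * \<i> * z)) * theta1 z \<tau>"
proof -
  define s where "s = exp (\<i> * z)"
  define p where "p = exp (\<i> * (of_real pi * \<tau>))"
  have nz: "s \<noteq> 0" "p \<noteq> 0" by (simp_all add: s_def p_def)
  have q: "qpow \<tau> 1 = p\<^sup>2" "qpow \<tau> (- 1/2) = inverse p"
    by (simp_all add: qpow_def p_def mult_ac flip: exp_double exp_minus)
  have e: "exp (- 2 * \<i> * z) = inverse s ^ 2"
    by (simp add: s_def mult_ac flip: exp_double exp_minus)
  have sp: "exp (\<i> * (z + of_real pi * \<tau>)) = s * p"
    by (simp add: s_def p_def distrib_left exp_add)
  let ?T = "theta_series \<tau>" and ?c = "theta_coeff \<tau> 0"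
  have "?T (s\<^sup>2) = ?c - p\<^sup>2 * s\<^sup>2 * ?T ((s * p)\<^sup>2)"
    using theta_series_rec[OF assms, of "s\<^sup>2"] by (simp add: q power_mult_distrib mult_ac)
  \<comment> \<open>The recursion is solved for the shifted value in the first half and applied
    directly in the second (\<open>B\<close>). Both halves then carry the term
    \<open>?c / (s * p)\<close>, which cancels in the difference.\<close>
  then have A: "?T ((s * p)\<^sup>2) = (?c - ?T (s\<^sup>2)) / (p\<^sup>2 * s\<^sup>2)"
    using nz by (simp add: field_simps)
  have B: "?T ((inverse (s * p))\<^sup>2) = ?c - inverse s ^ 2 * ?T ((inverse s)\<^sup>2)"
    using theta_series_rec[OF assms, of "(inverse (s * p))\<^sup>2"] nz
    by (simp add: q power_mult_distrib power_inverse field_simps)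
  show ?thesis
    unfolding theta1_eq[OF assms] sp e q s_def[symmetric] A B
    using nz by (simp add: field_simps power2_eq_square)
qed

text \<open>If \<open>theta1\<close> vanished, then \<open>w * theta_series w = theta_series (1/w)\<close>, so the entire
  function \<open>theta_series\<close> would tend to zero at infinity, contradicting Liouville.\<close>

lemma theta1_not_identically_zero:
  assumes "Im \<tau> > 0"
  obtains z where "theta1 z \<tau> \<noteq> 0"
proof (rule ccontr)
  assume "\<not> thesis"
  then have zero: "theta1 z \<tau> = 0" for z using that by blast
  let ?T = "theta_series \<tau>"
  have T_eq: "?T w = inverse w * ?T (inverse w)" if "w \<noteq> 0" for w
  proof -
    \<comment> \<open>Every nonzero \<open>w\<close> is \<open>exp (\<i> * z) ^ 2\<close> for
      \<open>z = - \<i> * Ln s\<close>.\<close>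
    define s where "s = csqrt w"
    have s: "s\<^sup>2 = w" "s \<noteq> 0" using that by (auto simp: s_def)
    have "exp (\<i> * (- \<i> * Ln s)) = s" using s by simp
    then have "s * ?T (s\<^sup>2) = inverse s * ?T ((inverse s)\<^sup>2)"
      using zero[of "- \<i> * Ln s"] unfolding theta1_eq[OF assms] by simp
    then have "?T (s\<^sup>2) = inverse (s\<^sup>2) * ?T (inverse (s\<^sup>2))"
      using s(2) by (simp add: field_simps power2_eq_square)
    then show ?thesis by (simp add: s)
  qed
  have "?T \<midarrow>0\<rightarrow> ?T 0"
    using theta_series_holomorphic[OF assms, of UNIV] holomorphic_on_imp_continuous_on
    by (metis UNIV_I continuous_on_eq_continuous_within isCont_def)
  moreover have "filterlim inverse (at (0::complex)) at_infinity"
    using filterlim_inverse_at_iff[of "\<lambda>w::complex. w"] by (simp add: filterlim_ident)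
  ultimately have "((\<lambda>w. ?T (inverse w)) \<longlongrightarrow> ?T 0) at_infinity"
    by (rule filterlim_compose)
  from tendsto_mult[OF tendsto_inverse_0 this]
  have "((\<lambda>w. inverse w * ?T (inverse w)) \<longlongrightarrow> 0) at_infinity"
    by simp
  moreover have "eventually (\<lambda>w::complex. ?T w = inverse w * ?T (inverse w)) at_infinity"
    using eventually_not_equal_at_infinity[of 0] by eventually_elim (rule T_eq)
  ultimately have "(?T \<longlongrightarrow> 0) at_infinity"
    by (simp add: tendsto_cong)
  then have "?T 0 = 0"
    by (intro Liouville_weak_0 theta_series_holomorphic assms)
  then have "theta_coeff \<tau> 0 = 0"
    by (simp add: theta_series_def powser_zero)
  with theta_coeff_0_nonzero show False ..
qed

text \<open>Zeros of an entire function that is not identically zero are isolated. The statement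
  near 0 with a scaling \<open>c\<close> lets several factors be made nonzero at a common
  point.\<close>

lemma theta1_eventually_nonzero:
  assumes "Im \<tau> > 0" "c \<noteq> 0"
  shows "eventually (\<lambda>z. theta1 (c * z) \<tau> \<noteq> 0) (at 0)"
proof -
  obtain z where "theta1 z \<tau> \<noteq> 0"
    using theta1_not_identically_zero[OF assms(1)] .
  then have "eventually (\<lambda>z. theta1 (c * z) \<tau> \<noteq> 0 \<and> z \<in> UNIV) (at 0)"
    using assms(2) by (intro non_zero_neighbour_alt[where \<beta> = "z / c"] holomorphic_intros assms(1)) auto
  then show ?thesis by simp
qed


section \<open>Odd theta functions of order six\<close>

text \<open>Order six because \<open>exp (12 * \<i> * z)\<close> is \<open>fourier_char 6 z\<close>,
  which moves Fourier indices by 6.\<close>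

definition odd_theta6 :: "complex \<Rightarrow> (complex \<Rightarrow> complex) \<Rightarrow> bool" where
  "odd_theta6 \<tau> f \<longleftrightarrow> entire_periodic f \<and> (\<forall>z. f (- z) = - f z) \<and>
     (\<forall>z. f z = qpow \<tau> 3 * exp (12 * \<i> * z) * f (z + of_real pi * \<tau>))"

lemma odd_theta6D:
  assumes "odd_theta6 \<tau> f"
  shows "entire_periodic f" "f holomorphic_on UNIV" "f (- z) = - f z"
    "f z = qpow \<tau> 3 * exp (12 * \<i> * z) * f (z + of_real pi * \<tau>)"
  using assms unfolding odd_theta6_def entire_periodic_def by blast+

lemma odd_theta6_add:
  assumes "odd_theta6 \<tau> f" "odd_theta6 \<tau> g"
  shows "odd_theta6 \<tau> (\<lambda>z. f z + g z)"
  unfolding odd_theta6_def entire_periodic_def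
proof (intro conjI allI)
  show "f z + g z = qpow \<tau> 3 * exp (12 * \<i> * z) * (f (z + of_real pi * \<tau>) + g (z + of_real pi * \<tau>))" for z
    using odd_theta6D(4)[OF assms(1), of z] odd_theta6D(4)[OF assms(2), of z]
    by (simp add: distrib_left)
qed (simp_all add: odd_theta6D(2,3)[OF assms(1)] odd_theta6D(2,3)[OF assms(2)] holomorphic_on_add
    entire_periodicD(2)[OF odd_theta6D(1)[OF assms(1)]] entire_periodicD(2)[OF odd_theta6D(1)[OF assms(2)]])

lemma odd_theta6_cmult:
  assumes "odd_theta6 \<tau> f"
  shows "odd_theta6 \<tau> (\<lambda>z. c * f z)"
  unfolding odd_theta6_def entire_periodic_def
proof (intro conjI allI)
  show "c * f z = qpow \<tau> 3 * exp (12 * \<i> * z) * (c * f (z + of_real pi * \<tau>))" for z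
    using odd_theta6D(4)[OF assms(1), of z] by simp
qed (simp_all add: odd_theta6D(2,3)[OF assms] entire_periodicD(2)[OF odd_theta6D(1)[OF assms]] holomorphic_intros)

text \<open>Compare coefficients in the functional equation: the exponential shifts the index by 6,
  and the translation contributes a character value. The total factor is
  \<open>q^(n-3)\<close>.\<close>

lemma odd_theta6_coeff_rec:
  assumes "odd_theta6 \<tau> f"
  shows "fourier_coeff f n =
    qpow \<tau> 3 * fourier_char (n - 6) (of_real pi * \<tau>) * fourier_coeff f (n - 6)"
proof -
  let ?g = "\<lambda>z. f (z + of_real pi * \<tau>)"
  have hol: "?g holomorphic_on UNIV"
    by (intro holomorphic_on_compose[OF _ holomorphic_on_subset[OF odd_theta6D(2)[OF assms]], unfolded o_def]
        holomorphic_intros) auto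
  have "f = (\<lambda>z. qpow \<tau> 3 * (fourier_char 6 z * ?g z))"
  proof
    show "f z = qpow \<tau> 3 * (fourier_char 6 z * ?g z)" for z
      using odd_theta6D(4)[OF assms, of z] by (simp add: fourier_char_def mult_ac)
  qed
  then have "fourier_coeff f n = fourier_coeff (\<lambda>z. qpow \<tau> 3 * (fourier_char 6 z * ?g z)) n"
    by (rule arg_cong)
  also have "\<dots> = qpow \<tau> 3 * fourier_coeff ?g (n - 6)"
    by (simp add: fourier_coeff_cmult fourier_coeff_mult_char holomorphic_intros hol)
  also have "fourier_coeff ?g (n - 6) = fourier_char (n - 6) (of_real pi * \<tau>) * fourier_coeff f (n - 6)"
    by (rule fourier_coeff_shift[OF odd_theta6D(1)[OF assms]])
  finally show ?thesis by simp
qed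

text \<open>The coefficients are determined by their indices modulo 6, and oddness kills the classes
  of 0 and 3 and pairs the class of 1 with 5 and that of 2 with 4.\<close>

lemma odd_theta6_eq_0:
  assumes f: "odd_theta6 \<tau> f" and "fourier_coeff f 1 = 0" "fourier_coeff f 2 = 0"
  shows "f z = 0"
proof -
  let ?a = "fourier_coeff f"
  have odd: "?a (- n) = - ?a n" for n
  proof -
    have "?a (- n) = fourier_coeff (\<lambda>z. (- 1) * f z) n"
      using fourier_coeff_reflect[OF odd_theta6D(1)[OF f], of n] by (simp add: odd_theta6D(3)[OF f])
    then show ?thesis
      by (simp only: fourier_coeff_cmult[OF odd_theta6D(2)[OF f]]) simp
  qed
  \<comment> \<open>The factor of the recursion is nonzero, so vanishing propagates in both
    directions.\<close>
  have step: "?a n = 0 \<longleftrightarrow> ?a (n - 6) = 0" for n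
    by (subst odd_theta6_coeff_rec[OF f]) simp
  have mod6: "?a (r + 6 * k) = 0 \<longleftrightarrow> ?a r = 0" for r k
  proof (induction k rule: int_induct[where k = 0])
    case (step1 i)
    then show ?case using step[of "r + 6 * (i + 1)"] by simp
  next
    case (step2 i)
    then show ?case using step[of "r + 6 * i"] by (simp add: algebra_simps)
  qed simp
  \<comment> \<open>At n = 3 the factor is \<open>q^0 = 1\<close>, which together with oddness
    forces \<open>?a 3 = - ?a 3\<close>.\<close>
  have "qpow \<tau> 3 * fourier_char (- 3) (of_real pi * \<tau>) = 1"
    by (simp add: qpow_def fourier_char_def flip: exp_add)
  then have "?a 3 = ?a (- 3)"
    using odd_theta6_coeff_rec[OF f, of 3] by simp
  then have "?a 3 = 0" using odd[of 3] by simp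
  moreover have "?a 0 = 0" using odd[of 0] by simp
  moreover have "?a 4 = 0" "?a 5 = 0"
    using step[of 4] step[of 5] odd[of 2] odd[of 1] assms by auto
  ultimately have base: "?a r = 0" if "r \<in> {0, 1, 2, 3, 4, 5}" for r
    using that assms by auto
  have "?a n = 0" for n
  proof -
    have "n mod 6 \<in> {0, 1, 2, 3, 4, 5}" by auto
    then show ?thesis using mod6[of "n mod 6" "n div 6"] base by simp
  qed
  then show ?thesis
    by (rule fourier_coeff_zero_imp_zero[OF odd_theta6D(1)[OF f]])
qed

text \<open>The coefficients of index 1 and 2 embed the space into a plane. The values at
  \<open>u\<close> and \<open>v\<close> make \<open>g\<close> and \<open>h\<close> independent,
  hence a basis; evaluating at \<open>u\<close> and \<open>v\<close> identifies the coordinates of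
  \<open>f\<close>.\<close>

lemma odd_theta6_interpolation:
  assumes f: "odd_theta6 \<tau> f" and g: "odd_theta6 \<tau> g" and h: "odd_theta6 \<tau> h"
    and "g u = 1" "g v = 0" "h u = 0" "h v = 1"
  shows "f z = f u * g z + f v * h z"
proof -
  let ?a = "\<lambda>f. fourier_coeff f 1" and ?b = "\<lambda>f. fourier_coeff f 2"
  have lin: "\<alpha> * f z + \<beta> * g z = 0"
    if "odd_theta6 \<tau> f" "odd_theta6 \<tau> g" "\<alpha> * ?a f + \<beta> * ?a g = 0" "\<alpha> * ?b f + \<beta> * ?b g = 0"
    for \<alpha> \<beta> f g z
  proof -
    have "fourier_coeff (\<lambda>z. \<alpha> * f z + \<beta> * g z) n = \<alpha> * fourier_coeff f n + \<beta> * fourier_coeff g n" for n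
      using odd_theta6D(2)[OF that(1)] odd_theta6D(2)[OF that(2)]
      by (simp add: fourier_coeff_add fourier_coeff_cmult holomorphic_intros)
    then show ?thesis
      using that by (intro odd_theta6_eq_0[of \<tau> "\<lambda>z. \<alpha> * f z + \<beta> * g z"] odd_theta6_add odd_theta6_cmult) auto
  qed
  have indep: "\<alpha> = 0 \<and> \<beta> = 0" if "\<alpha> * ?a g + \<beta> * ?a h = 0" "\<alpha> * ?b g + \<beta> * ?b h = 0" for \<alpha> \<beta>
    using lin[OF g h that, of u] lin[OF g h that, of v] assms by simp
  define D where "D = ?a g * ?b h - ?a h * ?b g"
  \<comment> \<open>If the determinant vanished, each of its rows would give a linear relation
    between \<open>g\<close> and \<open>h\<close>. Independence makes all four entries zero, and
    then (1, 0) would be a relation as well.\<close>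
  have D: "D \<noteq> 0"
  proof
    assume "D = 0"
    then have rel: "?a h * ?a g + (- ?a g) * ?a h = 0" "?a h * ?b g + (- ?a g) * ?b h = 0"
        "?b h * ?a g + (- ?b g) * ?a h = 0" "?b h * ?b g + (- ?b g) * ?b h = 0"
      by (simp_all add: D_def algebra_simps)
    then have "?a h = 0" "?a g = 0" "?b h = 0" "?b g = 0"
      using indep[OF rel(1,2)] indep[OF rel(3,4)] by simp_all
    then show False using indep[of 1 0] by simp
  qed
  \<comment> \<open>Cramer's rule for matching the two coefficients of \<open>f\<close>.\<close>
  define \<alpha> \<beta> where "\<alpha> = (?a f * ?b h - ?a h * ?b f) / D" and "\<beta> = (?a g * ?b f - ?a f * ?b g) / D"
  let ?k = "\<lambda>z. \<alpha> * g z + \<beta> * h z"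
  have k: "odd_theta6 \<tau> ?k"
    by (intro odd_theta6_add odd_theta6_cmult g h)
  have kc: "fourier_coeff ?k n = \<alpha> * fourier_coeff g n + \<beta> * fourier_coeff h n" for n
    using odd_theta6D(2)[OF g] odd_theta6D(2)[OF h]
    by (simp add: fourier_coeff_add fourier_coeff_cmult holomorphic_intros)
  have "\<alpha> * ?a g + \<beta> * ?a h = ?a f * D / D" "\<alpha> * ?b g + \<beta> * ?b h = ?b f * D / D"
    by (simp_all add: \<alpha>_def \<beta>_def D_def algebra_simps flip: add_divide_distrib diff_divide_distrib)
  then have "?a ?k = ?a f" "?b ?k = ?b f"
    using D by (simp_all add: kc)
  then have eq: "f z = \<alpha> * g z + \<beta> * h z" for z
    using lin[OF f k, of 1 "- 1" z] by (simp add: algebra_simps)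
  show ?thesis
    using eq[of z] eq[of u] eq[of v] assms by simp
qed

text \<open>\<open>\<phi>\<close> and \<open>\<psi>\<close> are rescaled sections of
  \<open>R\<close>, dual to evaluation at \<open>u\<close> and \<open>v\<close>. In this basis both
  \<open>R\<close> and the left-hand side are multiples of
  \<open>\<phi> x * \<psi> y - \<phi> y * \<psi> x\<close>.\<close>

lemma odd_theta6_antisymmetric_kernel:
  assumes R: "\<And>y. odd_theta6 \<tau> (\<lambda>x. R x y)" and anti: "\<And>x y. R y x = - R x y"
    and nz: "R u v \<noteq> 0" and f: "odd_theta6 \<tau> f" and g: "odd_theta6 \<tau> g"
  shows "f x * g y - f y * g x = (f u * g v - f v * g u) / R u v * R x y"
proof -
  define \<phi> \<psi> where "\<phi> = (\<lambda>x. inverse (R u v) * R x v)" and "\<psi> = (\<lambda>x. inverse (R v u) * R x u)"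
  have diag: "R x x = 0" for x
    using anti[of x x, unfolded eq_neg_iff_add_eq_0] by simp
  have nz': "R v u \<noteq> 0" using nz anti[of u v] by simp
  have \<phi>: "odd_theta6 \<tau> \<phi>" and \<psi>: "odd_theta6 \<tau> \<psi>"
    unfolding \<phi>_def \<psi>_def by (intro odd_theta6_cmult R)+
  note expand = odd_theta6_interpolation[OF _ \<phi> \<psi>, of _ u v]
  have v: "\<phi> u = 1" "\<phi> v = 0" "\<psi> u = 0" "\<psi> v = 1"
    using nz nz' by (simp_all add: \<phi>_def \<psi>_def diag)
  have "R x y = R u y * \<phi> x + R v y * \<psi> x"
    by (rule expand[OF R v])
  \<comment> \<open>Antisymmetry turns the coordinates of \<open>R\<close>, as a function of
    \<open>x\<close>, back into sections evaluated at \<open>y\<close>.\<close>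
  moreover have "R u y = R u v * \<psi> y" "R v y = - (R u v * \<phi> y)"
    using nz nz' anti[of u y] anti[of v y] anti[of u v] by (simp_all add: \<phi>_def \<psi>_def)
  ultimately have R_eq: "R x y = R u v * (\<phi> x * \<psi> y - \<phi> y * \<psi> x)"
    by (simp add: algebra_simps)
  have "f x * g y - f y * g x = (f u * g v - f v * g u) * (\<phi> x * \<psi> y - \<phi> y * \<psi> x)"
    unfolding expand[OF f v, of x] expand[OF f v, of y] expand[OF g v, of x] expand[OF g v, of y]
    by (simp add: algebra_simps)
  then show ?thesis
    using nz by (simp add: R_eq)
qed

section \<open>Both sides of the identity as odd theta functions of order six\<close>

lemma odd_theta6_odd_part:
  assumes hol: "F holomorphic_on UNIV" and per: "\<And>z. F z = F (z + of_real pi)"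
    and qper: "\<And>z. F (z + of_real pi) = qpow \<tau> 3 * exp (12 * \<i> * z) * F (z + of_real pi * \<tau>)"
  shows "odd_theta6 \<tau> (\<lambda>z. F z - F (- z))"
  unfolding odd_theta6_def entire_periodic_def
proof (intro conjI allI)
  have hol': "(\<lambda>z. F (- z)) holomorphic_on UNIV"
    by (intro holomorphic_on_compose[OF _ holomorphic_on_subset[OF hol], unfolded o_def] holomorphic_intros) auto
  show "(\<lambda>z. F z - F (- z)) holomorphic_on UNIV"
    by (intro holomorphic_intros hol hol')
  fix z
  show "F (z + of_real pi) - F (- (z + of_real pi)) = F z - F (- z)"
    using per[of z] per[of "- z - of_real pi"] by simp
  show "F (- z) - F (- (- z)) = - (F z - F (- z))"
    by simp
  \<comment> \<open>The functional equation at \<open>- z - pi * \<tau>\<close> relates the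
    reflected values. Its multiplier is inverse to the one at \<open>z\<close>, since the powers
    \<open>q^6\<close> and \<open>q^(-6)\<close> cancel.\<close>
  have neg: "F (- (z + of_real pi * \<tau>)) = qpow \<tau> 3 * exp (12 * \<i> * (- z - of_real pi * \<tau>)) * F (- z)"
    using per[of "- z - of_real pi * \<tau>"] qper[of "- z - of_real pi * \<tau>"] by simp
  have "(qpow \<tau> 3 * exp (12 * \<i> * z)) * (qpow \<tau> 3 * exp (12 * \<i> * (- z - of_real pi * \<tau>))) = 1"
    by (simp add: qpow_def algebra_simps flip: exp_add)
  then have "F (- z) = qpow \<tau> 3 * exp (12 * \<i> * z) * F (- (z + of_real pi * \<tau>))"
    unfolding neg by (simp only: mult.assoc[symmetric] mult_1_left)
  with per[of z] qper[of z] show "F z - F (- z) = qpow \<tau> 3 * exp (12 * \<i> * z) *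
      (F (z + of_real pi * \<tau>) - F (- (z + of_real pi * \<tau>)))"
    by (simp only: right_diff_distrib)
qed

text \<open>In the quasi-period the \<open>y\<close>-dependence of the first two multipliers
  cancels; together with the two from \<open>theta1 (2 * x)\<close> they give
  \<open>q^(-3) * exp (- 12 * \<i> * x)\<close>.\<close>

lemma odd_theta6_theta1_product:
  assumes "Im \<tau> > 0"
  shows "odd_theta6 \<tau> (\<lambda>x. theta1 (x - y) \<tau> * theta1 (x + y) \<tau> * theta1 (2 * x) \<tau> * theta1 (2 * y) \<tau>)"
  unfolding odd_theta6_def entire_periodic_def
proof (intro conjI allI)
  note tau = theta1_add_pi_tau[OF assms] and shift_pi = theta1_add_pi[OF assms]
    and minus = theta1_minus[OF assms]
  show "(\<lambda>x. theta1 (x - y) \<tau> * theta1 (x + y) \<tau> * theta1 (2 * x) \<tau> * theta1 (2 * y) \<tau>) holomorphic_on UNIV"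
    by (intro holomorphic_intros assms)
  fix x
  have "theta1 (x + of_real pi - y) \<tau> = - theta1 (x - y) \<tau>"
       "theta1 (x + of_real pi + y) \<tau> = - theta1 (x + y) \<tau>"
       "theta1 (2 * (x + of_real pi)) \<tau> = theta1 (2 * x) \<tau>"
    using shift_pi[of "x - y"] shift_pi[of "x + y"] shift_pi[of "2 * x"] shift_pi[of "2 * x + of_real pi"]
    by (simp_all add: algebra_simps)
  then show "theta1 (x + of_real pi - y) \<tau> * theta1 (x + of_real pi + y) \<tau> * theta1 (2 * (x + of_real pi)) \<tau>
      * theta1 (2 * y) \<tau> = theta1 (x - y) \<tau> * theta1 (x + y) \<tau> * theta1 (2 * x) \<tau> * theta1 (2 * y) \<tau>"
    by simp
  show "theta1 (- x - y) \<tau> * theta1 (- x + y) \<tau> * theta1 (2 * - x) \<tau> * theta1 (2 * y) \<tau> =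
      - (theta1 (x - y) \<tau> * theta1 (x + y) \<tau> * theta1 (2 * x) \<tau> * theta1 (2 * y) \<tau>)"
    using minus[of "x - y"] minus[of "x + y"] minus[of "2 * x"] by (simp add: algebra_simps)
  let ?x = "x + of_real pi * \<tau>" and ?m = "\<lambda>z. - (qpow \<tau> (- 1/2) * exp (- 2 * \<i> * z))"
  have 1: "theta1 (?x - y) \<tau> = ?m (x - y) * theta1 (x - y) \<tau>"
    using tau[of "x - y"] by (simp add: algebra_simps)
  have 2: "theta1 (?x + y) \<tau> = ?m (x + y) * theta1 (x + y) \<tau>"
    using tau[of "x + y"] by (simp add: algebra_simps)
  \<comment> \<open>The argument \<open>2 * x\<close> moves by two quasi-periods, so the law is
    applied twice.\<close>
  have "theta1 (2 * ?x) \<tau> = theta1 (2 * x + of_real pi * \<tau> + of_real pi * \<tau>) \<tau>"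
    by (simp add: algebra_simps)
  then have 3: "theta1 (2 * ?x) \<tau> = ?m (2 * x + of_real pi * \<tau>) * (?m (2 * x) * theta1 (2 * x) \<tau>)"
    by (simp only: tau)
  have m: "qpow \<tau> 3 * exp (12 * \<i> * x) * (?m (x - y) * ?m (x + y) * ?m (2 * x + of_real pi * \<tau>) * ?m (2 * x)) = 1"
    by (simp add: qpow_def algebra_simps flip: exp_add)
  have reorder: "a * b * c * d = k * (m1 * a * (m2 * b) * (m3 * (m4 * c)) * d)"
    if "k * (m1 * m2 * m3 * m4) = 1" for a b c d k m1 m2 m3 m4 :: complex
  proof -
    have "k * (m1 * a * (m2 * b) * (m3 * (m4 * c)) * d) = (k * (m1 * m2 * m3 * m4)) * (a * b * c * d)"
      by (simp only: mult_ac)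
    with that show ?thesis by simp
  qed
  show "theta1 (x - y) \<tau> * theta1 (x + y) \<tau> * theta1 (2 * x) \<tau> * theta1 (2 * y) \<tau> =
      qpow \<tau> 3 * exp (12 * \<i> * x) *
      (theta1 (?x - y) \<tau> * theta1 (?x + y) \<tau> * theta1 (2 * ?x) \<tau> * theta1 (2 * y) \<tau>)"
    unfolding 1 2 3 by (rule reorder[OF m])
qed

theorem theorem1p17:
  fixes \<tau> :: complex and F G :: "complex \<Rightarrow> complex"
  assumes "Im \<tau> > 0"
    and "F holomorphic_on UNIV" and "G holomorphic_on UNIV"
    and "\<And>z. F z = F (z + of_real pi)"
    and "\<And>z. F (z + of_real pi) = qpow \<tau> 3 * exp (12 * \<i> * z) * F (z + of_real pi * \<tau>)"
    and "\<And>z. G z = G (z + of_real pi)"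
    and "\<And>z. G (z + of_real pi) = qpow \<tau> 3 * exp (12 * \<i> * z) * G (z + of_real pi * \<tau>)"
  shows "\<exists>C::complex. \<forall>x y.
    (F x - F (- x)) * (G y - G (- y)) - (F y - F (- y)) * (G x - G (- x))
      = C * theta1 (x - y) \<tau> * theta1 (x + y) \<tau> * theta1 (2 * x) \<tau> * theta1 (2 * y) \<tau>"
proof -
  define R where "R = (\<lambda>x y. theta1 (x - y) \<tau> * theta1 (x + y) \<tau> * theta1 (2 * x) \<tau> * theta1 (2 * y) \<tau>)"
  have R: "odd_theta6 \<tau> (\<lambda>x. R x y)" for y
    unfolding R_def by (rule odd_theta6_theta1_product[OF assms(1)])
  have anti: "R y x = - R x y" for x y
    using theta1_minus[OF assms(1), of "x - y"] by (simp add: R_def add.commute)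
  \<comment> \<open>At the point \<open>(3 * t, t)\<close> the factors of \<open>R\<close> have
    arguments 2t, 4t, 6t and 2t.\<close>
  have "eventually (\<lambda>t. theta1 (2 * t) \<tau> \<noteq> 0 \<and> theta1 (4 * t) \<tau> \<noteq> 0 \<and> theta1 (6 * t) \<tau> \<noteq> 0) (at 0)"
    by (intro eventually_conj theta1_eventually_nonzero assms(1)) auto
  then obtain t where "theta1 (2 * t) \<tau> \<noteq> 0" "theta1 (4 * t) \<tau> \<noteq> 0" "theta1 (6 * t) \<tau> \<noteq> 0"
    by (auto dest!: eventually_happens)
  then have nz: "R (3 * t) t \<noteq> 0"
    by (simp add: R_def)
  note F = odd_theta6_odd_part[OF assms(2,4,5)] and G = odd_theta6_odd_part[OF assms(3,6,7)]
  from odd_theta6_antisymmetric_kernel[of \<tau> R, OF R anti nz F G] show ?thesis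
    unfolding R_def mult.assoc[symmetric] by blast
qed

end
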